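(* Let $g>0$, $H>0$ and $U\in\mathbb{R}$ with $U^2>gH$ (super-critical flow), and let $\alpha\ge0$. Consider the semi-discrete finite volume approximation $$(I_2\otimes P)\frac{d\bar{\mathbf{q}}}{dt}+(M\otimes Q)\bar{\mathbf{q}}-\frac{\alpha}{2}(I_2\otimes A)\bar{\mathbf{q}}=\mathrm{SAT},\qquad t\ge 0,$$ with the penalty term (homogeneous boundary data) $$\mathrm{SAT}=-\frac12\left(W^{-1}SW\otimes I_{N+1}\right)\begin{bmatrix}\tau_{01}H\,\mathbf{e}_0\,\bar w_1\big|_{i=0}\\ \tau_{02}\,g\,\mathbf{e}_0\,\bar w_2\big|_{i=0}\end{bmatrix}\quad\text{if }U>0,$$ $$\mathrm{SAT}=-\frac12\left(W^{-1}SW\otimes I_{N+1}\right)\begin{bmatrix}\tau_{N1}H\,\mathbf{e}_N\,\bar w_1\big|_{i=N}\\ \tau_{N2}\,g\,\mathbf{e}_N\,\bar w_2\big|_{i=N}\end{bmatrix}\quad\text{if }U<0.$$ If the real penalty parameters are chosen such that $$\tau_{01}\ge\lambda_1,\quad\tau_{02}\ge\lambda_2,\quad\tau_{N1}\ge-\lambda_1,\quad\tau_{N2}\ge-\lambda_2$$ (the first two being the relevant ones for $U>0$ and the last two for $U<0$), then every solution $\bar{\mathbf{q}}$ satisfies $$\frac12\frac{d}{dt}\Vert\bar{\mathbf{q}}\Vert_{WP}^2\le 0\qquad\text{for all }t\ge 0.$$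
   Context: Continuous data: $M=\begin{bmatrix}U&H\\ g&U\end{bmatrix}$, $W=\begin{bmatrix}g&0\\0&H\end{bmatrix}$, $$\lambda_{1}=\frac{1}{2gH}\left(U(g+H)+\sqrt{U^2(g+H)^2+4gH(gH-U^2)}\right),$$ $$\lambda_{2}=\frac{1}{2gH}\left(U(g+H)-\sqrt{U^2(g+H)^2+4gH(gH-U^2)}\right),$$ $$S=\begin{bmatrix}\frac1c\left(\lambda_1-\frac Ug\right)&\frac1d\left(\lambda_2-\frac Ug\right)\\ \frac1c&\frac1d\end{bmatrix},\quad c=\sqrt{\left(\lambda_1-\tfrac Ug\right)^2+1},\quad d=\sqrt{\left(\lambda_2-\tfrac Ug\right)^2+1}.$$ For super-critical flow both $\lambda_1$ and $\lambda_2$ have the sign of $U$. Grid: $N\ge1$, nodes $0=x_0<x_1<\dots<x_N=1$, $\Delta x_i=x_i-x_{i-1}>0$, and control cell lengths $|I_0|=\Delta x_1/2$, $|I_i|=(\Delta x_i+\Delta x_{i+1})/2$ for $1\le i\le N-1$, $|I_N|=\Delta x_N/2$. Matrices of size $(N+1)\times(N+1)$ (indices $0,\dots,N$): $P=\mathrm{diag}(|I_0|,\dots,|I_N|)$. $Q$ has first row $(-\frac12,\frac12,0,\dots,0)$, last row $(0,\dots,0,-\frac12,\frac12)$, and for $1\le i\le N-1$ its row $i$ has entries $Q_{i,i-1}=-\frac12$, $Q_{i,i+1}=\frac12$ and zeros elsewhere. $A$ has first row $(-1,1,0,\dots,0)$, last row $(0,\dots,0,1,-1)$, and for $1\le i\le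 N-1$ its row $i$ has entries $A_{i,i-1}=1$, $A_{i,i}=-2$, $A_{i,i+1}=1$ and zeros elsewhere. The unknown $\bar{\mathbf{q}}(t)\in\mathbb{R}^{2(N+1)}$ collects the cell averages $\bar{\mathbf{q}}_i=[\bar h_i,\bar u_i]^\top$, ordered compatibly with the Kronecker products, i.e. $\bar{\mathbf{q}}=(\bar h_0,\dots,\bar h_N,\bar u_0,\dots,\bar u_N)^\top$. At each node $i$, $[\bar w_1,\bar w_2]^\top|_i=S^\top\bar{\mathbf{q}}_i$. $\mathbf{e}_0=(1,0,\dots,0)^\top$ and $\mathbf{e}_N=(0,\dots,0,1)^\top$ in $\mathbb{R}^{N+1}$; $I_k$ is the $k\times k$ identity and $\otimes$ the Kronecker product. The discrete norm is $\Vert\bar{\mathbf{q}}\Vert_{WP}^2=\bar{\mathbf{q}}^\top(W\otimes P)\bar{\mathbf{q}}$. *)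

theory Defs
  imports Complex_Main "Jordan_Normal_Form.Gauss_Jordan_Elimination"
begin

text \<open>
  Vectors and matrices of arbitrary size (depending on the number of cells) are those of
  Jordan_Normal_Form, with indices starting at 0.
\<close>

definition kron :: "'a::times mat \<Rightarrow> 'a mat \<Rightarrow> 'a mat"  (infixr \<open>\<otimes>\<^sub>K\<close> 75) where
  "A \<otimes>\<^sub>K B = mat (dim_row A * dim_row B) (dim_col A * dim_col B)
     (\<lambda>(i, j). A $$ (i div dim_row B, j div dim_col B) * B $$ (i mod dim_row B, j mod dim_col B))"

lemma dim_kron [simp]:
  "dim_row (A \<otimes>\<^sub>K B) = dim_row A * dim_row B"
  "dim_col (A \<otimes>\<^sub>K B) = dim_col A * dim_col B"
  by (simp_all add: kron_def)

text \<open>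
  The vector type carries no topology, so the derivative of a vector-valued function is taken
  entrywise. At a boundary point of \<open>T\<close> it is one-sided.
\<close>

definition has_vec_deriv :: "(real \<Rightarrow> real vec) \<Rightarrow> real vec \<Rightarrow> real \<Rightarrow> real set \<Rightarrow> bool" where
  "has_vec_deriv q v t T \<longleftrightarrow>
     (\<forall>s\<in>T. dim_vec (q s) = dim_vec v) \<and>
     (\<forall>i<dim_vec v. ((\<lambda>s. q s $ i) has_real_derivative v $ i) (at t within T))"

definition M_mat :: "real \<Rightarrow> real \<Rightarrow> real \<Rightarrow> real mat" where
  "M_mat g H U = mat_of_rows_list 2 [[U, H], [g, U]]"

definition W_mat :: "real \<Rightarrow> real \<Rightarrow> real mat" where
  "W_mat g H = mat_of_rows_list 2 [[g, 0], [0, H]]"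

definition W_inv :: "real \<Rightarrow> real \<Rightarrow> real mat" where
  "W_inv g H = the (mat_inverse (W_mat g H))"

lemma W_inv_inverse:
  assumes "g > 0" "H > 0"
  shows "W_mat g H * W_inv g H = 1\<^sub>m 2" "W_inv g H * W_mat g H = 1\<^sub>m 2"
    "W_inv g H \<in> carrier_mat 2 2"
proof -
  define w where "w = (\<lambda>i::nat. if i = 0 then g else H)"
  have w: "w i \<noteq> 0" for i
    using assms by (simp add: w_def)
  have eq: "W_mat g H = mat_diag 2 w"
    by (rule eq_matI)
      (auto simp: W_mat_def mat_of_rows_list_def mat_diag_def w_def dest!: less_2_cases)
  let ?B = "mat_diag 2 (\<lambda>i. inverse (w i))"
  have W: "W_mat g H \<in> carrier_mat 2 2" and B: "?B \<in> carrier_mat 2 2"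
    by (simp_all only: eq mat_diag_dim)
  have WB: "W_mat g H * ?B = 1\<^sub>m 2" and BW: "?B * W_mat g H = 1\<^sub>m 2"
    by (simp_all only: eq mat_diag_diag left_inverse[OF w] right_inverse[OF w] mat_diag_one)
  have "W_mat g H \<in> Units (ring_mat TYPE(real) 2 ())"
    unfolding Units_def ring_mat_simps mem_Collect_eq using W B WB BW by (intro conjI bexI)
  then have "mat_inverse (W_mat g H) \<noteq> None"
    using mat_inverse(1)[OF W] by metis
  then obtain C where C: "mat_inverse (W_mat g H) = Some C"
    by (meson not_None_eq)
  have "W_inv g H = C"
    by (simp only: W_inv_def C option.sel)
  with mat_inverse(2)[OF W C]
  show "W_mat g H * W_inv g H = 1\<^sub>m 2" "W_inv g H * W_mat g H = 1\<^sub>m 2"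
    "W_inv g H \<in> carrier_mat 2 2"
    by (simp_all only:)
qed

definition lambda1 :: "real \<Rightarrow> real \<Rightarrow> real \<Rightarrow> real" where
  "lambda1 g H U = 1 / (2 * g * H) *
     (U * (g + H) + sqrt (U\<^sup>2 * (g + H)\<^sup>2 + 4 * g * H * (g * H - U\<^sup>2)))"

definition lambda2 :: "real \<Rightarrow> real \<Rightarrow> real \<Rightarrow> real" where
  "lambda2 g H U = 1 / (2 * g * H) *
     (U * (g + H) - sqrt (U\<^sup>2 * (g + H)\<^sup>2 + 4 * g * H * (g * H - U\<^sup>2)))"

definition S_mat :: "real \<Rightarrow> real \<Rightarrow> real \<Rightarrow> real mat" where
  "S_mat g H U =
    (let a1 = lambda1 g H U - U / g;
         a2 = lambda2 g H U - U / g;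
         c = sqrt (a1\<^sup>2 + 1);
         d = sqrt (a2\<^sup>2 + 1)
     in mat_of_rows_list 2 [[1 / c * a1, 1 / d * a2], [1 / c, 1 / d]])"

definition dx :: "(nat \<Rightarrow> real) \<Rightarrow> nat \<Rightarrow> real" where
  "dx x i = x i - x (i - 1)"

definition is_grid :: "nat \<Rightarrow> (nat \<Rightarrow> real) \<Rightarrow> bool" where
  "is_grid N x \<longleftrightarrow> x 0 = 0 \<and> x N = 1 \<and> (\<forall>i\<in>{1..N}. dx x i > 0)"

definition cell_length :: "nat \<Rightarrow> (nat \<Rightarrow> real) \<Rightarrow> nat \<Rightarrow> real" where
  "cell_length N x i =
    (if i = 0 then dx x 1 / 2
     else if i = N then dx x N / 2
     else (dx x i + dx x (i + 1)) / 2)"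

definition P_mat :: "nat \<Rightarrow> (nat \<Rightarrow> real) \<Rightarrow> real mat" where
  "P_mat N x = mat_diag (N + 1) (cell_length N x)"

text \<open>In the next two definitions the case distinctions are meant for \<open>N \<ge> 1\<close>.\<close>

definition Q_mat :: "nat \<Rightarrow> real mat" where
  "Q_mat N = mat (N + 1) (N + 1) (\<lambda>(i, j).
     if i = 0 then (if j = 0 then - 1/2 else if j = 1 then 1/2 else 0)
     else if i = N then (if j = N - 1 then - 1/2 else if j = N then 1/2 else 0)
     else (if j = i - 1 then - 1/2 else if j = i + 1 then 1/2 else 0))"

definition A_mat :: "nat \<Rightarrow> real mat" where
  "A_mat N = mat (N + 1) (N + 1) (\<lambda>(i, j).
     if i = 0 then (if j = 0 then - 1 else if j = 1 then 1 else 0)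
     else if i = N then (if j = N - 1 then 1 else if j = N then - 1 else 0)
     else (if j = i - 1 then 1 else if j = i then - 2 else if j = i + 1 then 1 else 0))"

text \<open>
  The unknown is ordered as \<open>(h\<^sub>0, \<dots>, h\<^sub>N, u\<^sub>0, \<dots>, u\<^sub>N)\<close>, so \<open>u\<^sub>i\<close> sits at position \<open>N + 1 + i\<close>.
\<close>

definition node_state :: "nat \<Rightarrow> real vec \<Rightarrow> nat \<Rightarrow> real vec" where
  "node_state N q i = vec_of_list [q $ i, q $ (N + 1 + i)]"

text \<open>Entry 0 of the following vector is \<open>w\<^sub>1\<close> and entry 1 is \<open>w\<^sub>2\<close>.\<close>

definition char_vars :: "real \<Rightarrow> real \<Rightarrow> real \<Rightarrow> nat \<Rightarrow> real vec \<Rightarrow> nat \<Rightarrow> real vec" where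
  "char_vars g H U N q i = transpose_mat (S_mat g H U) *\<^sub>v node_state N q i"

definition penalty ::
  "real \<Rightarrow> real \<Rightarrow> real \<Rightarrow> nat \<Rightarrow> real \<Rightarrow> real \<Rightarrow> nat \<Rightarrow> real vec \<Rightarrow> real vec" where
  "penalty g H U N \<tau>1 \<tau>2 i q =
     (- (1 / 2)) \<cdot>\<^sub>v
     (((W_inv g H * S_mat g H U * W_mat g H) \<otimes>\<^sub>K 1\<^sub>m (N + 1)) *\<^sub>v
      (((\<tau>1 * H * char_vars g H U N q i $ 0) \<cdot>\<^sub>v unit_vec (N + 1) i) @\<^sub>v
       ((\<tau>2 * g * char_vars g H U N q i $ 1) \<cdot>\<^sub>v unit_vec (N + 1) i)))"

text \<open>The case \<open>U = 0\<close> is irrelevant: it does not occur for super-critical flow.\<close>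

definition SAT ::
  "real \<Rightarrow> real \<Rightarrow> real \<Rightarrow> nat \<Rightarrow> real \<Rightarrow> real \<Rightarrow> real \<Rightarrow> real \<Rightarrow> real vec \<Rightarrow> real vec" where
  "SAT g H U N \<tau>01 \<tau>02 \<tau>N1 \<tau>N2 q =
     (if U > 0 then penalty g H U N \<tau>01 \<tau>02 0 q else penalty g H U N \<tau>N1 \<tau>N2 N q)"

definition is_solution ::
  "real \<Rightarrow> real \<Rightarrow> real \<Rightarrow> real \<Rightarrow> nat \<Rightarrow> (nat \<Rightarrow> real) \<Rightarrow>
   real \<Rightarrow> real \<Rightarrow> real \<Rightarrow> real \<Rightarrow> (real \<Rightarrow> real vec) \<Rightarrow> bool" where
  "is_solution g H U \<alpha> N x \<tau>01 \<tau>02 \<tau>N1 \<tau>N2 q \<longleftrightarrow>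
    (\<forall>t\<ge>0. \<exists>v\<in>carrier_vec (2 * (N + 1)).
       has_vec_deriv q v t {0..} \<and>
       (1\<^sub>m 2 \<otimes>\<^sub>K P_mat N x) *\<^sub>v v + (M_mat g H U \<otimes>\<^sub>K Q_mat N) *\<^sub>v q t
         - (\<alpha> / 2) \<cdot>\<^sub>v ((1\<^sub>m 2 \<otimes>\<^sub>K A_mat N) *\<^sub>v q t)
       = SAT g H U N \<tau>01 \<tau>02 \<tau>N1 \<tau>N2 (q t))"

definition WP_norm_sq :: "real \<Rightarrow> real \<Rightarrow> nat \<Rightarrow> (nat \<Rightarrow> real) \<Rightarrow> real vec \<Rightarrow> real" where
  "WP_norm_sq g H N x q = q \<bullet> ((W_mat g H \<otimes>\<^sub>K P_mat N x) *\<^sub>v q)"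

end

theory Submission
  imports Defs
begin

text \<open>
  Multiply the scheme by \<open>q\<^sup>T (W \<otimes> I)\<close>. Since \<open>W M\<close> is symmetric and \<open>Q + Q\<^sup>T = diag(-1, 0, \<dots>, 0, 1)\<close>, the
  transport term reduces to boundary values of the quadratic form of \<open>W M\<close>, while \<open>A\<close> is negative
  semidefinite. The columns of \<open>S\<close> are orthonormal eigenvectors of \<open>W M\<close> with eigenvalues
  \<open>g H \<lambda>\<^sub>1\<close> and \<open>g H \<lambda>\<^sub>2\<close>, so at the inflow boundary the penalty outweighs the transport term. At the
  outflow boundary nothing is needed, because super-criticality makes \<open>W M\<close> definite with the sign of \<open>U\<close>.
\<close>

section \<open>Kronecker products acting on vectors\<close>

lemma sum_lessThan_mult:
  fixes f :: "nat \<Rightarrow> 'a::comm_monoid_add"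
  shows "(\<Sum>i<m * n. f i) = (\<Sum>j<m. \<Sum>k<n. f (j * n + k))"
proof -
  have "sum f {j * n..<j * n + n} = (\<Sum>k<n. f (j * n + k))" for j
    using sum.shift_bounds_nat_ivl[of f 0 "j * n" n]
    by (simp add: atLeast0LessThan add.commute)
  then show ?thesis
    by (simp flip: sum.nat_group)
qed

lemma sum_lessThan_double:
  fixes f :: "nat \<Rightarrow> 'a::comm_monoid_add"
  shows "(\<Sum>i<2 * n. f i) = (\<Sum>i<n. f i) + (\<Sum>i<n. f (n + i))"
  unfolding sum_lessThan_mult[of f 2] by (simp add: lessThan_Suc add.commute numeral_2_eq_2)

text \<open>Position \<open>i * dim_row B + k\<close> is entry \<open>k\<close> of block
  \<open>i\<close>. The product applies \<open>B\<close> inside every block of \<open>v\<close> and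
  then combines the resulting blocks with row \<open>i\<close> of \<open>A\<close>.\<close>

lemma index_kron_mult_vec:
  fixes A B :: "'a::comm_semiring_0 mat"
  assumes "dim_vec v = dim_col A * dim_col B" and i: "i < dim_row A" and k: "k < dim_row B"
  shows "((A \<otimes>\<^sub>K B) *\<^sub>v v) $ (i * dim_row B + k) =
    (\<Sum>j<dim_col A. A $$ (i, j) * (\<Sum>l<dim_col B. B $$ (k, l) * v $ (j * dim_col B + l)))"
proof -
  \<comment> \<open>Block number and offset stay in range together, so that the \<open>div\<close>
    and \<open>mod\<close> in \<open>kron\<close> recover them.\<close>
  have less: "a * n + b < m * n" if "a < m" "b < n" for a b m n :: nat
  proof -
    have "a * n + b < Suc a * n" using that by simp
    also have "\<dots> \<le> m * n" using that by (intro mult_le_mono1) simp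
    finally show ?thesis .
  qed
  have entry: "(A \<otimes>\<^sub>K B) $$ (i * dim_row B + k, j * dim_col B + l) = A $$ (i, j) * B $$ (k, l)"
    if "j < dim_col A" "l < dim_col B" for j l
    using that i k by (simp add: kron_def less)
  have "((A \<otimes>\<^sub>K B) *\<^sub>v v) $ (i * dim_row B + k) =
      (\<Sum>c<dim_col A * dim_col B. (A \<otimes>\<^sub>K B) $$ (i * dim_row B + k, c) * v $ c)"
    using assms less[OF i k] by (simp add: scalar_prod_def atLeast0LessThan)
  also have "\<dots> = (\<Sum>j<dim_col A. \<Sum>l<dim_col B. A $$ (i, j) * B $$ (k, l) * v $ (j * dim_col B + l))"
    by (simp add: sum_lessThan_mult entry)
  finally show ?thesis
    by (simp add: sum_distrib_left mult.assoc)
qed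

text \<open>With two blocks the heights fill the first half of the vector and the velocities the
  second half. The scheme thereby splits into two scalar equations per node.\<close>

lemma index_kron2_mult_vec:
  fixes A B :: "'a::comm_semiring_0 mat"
  assumes "A \<in> carrier_mat 2 2" "B \<in> carrier_mat n n" "dim_vec v = 2 * n" "i < n"
  shows "((A \<otimes>\<^sub>K B) *\<^sub>v v) $ i =
      A $$ (0, 0) * (\<Sum>l<n. B $$ (i, l) * v $ l) + A $$ (0, 1) * (\<Sum>l<n. B $$ (i, l) * v $ (n + l))"
    and "((A \<otimes>\<^sub>K B) *\<^sub>v v) $ (n + i) =
      A $$ (1, 0) * (\<Sum>l<n. B $$ (i, l) * v $ l) + A $$ (1, 1) * (\<Sum>l<n. B $$ (i, l) * v $ (n + l))"
proof -
  have dim: "dim_row A = 2" "dim_col A = 2" "dim_row B = n" "dim_col B = n"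
    using assms by auto
  have sum2: "(\<Sum>j<2. c j) = c 0 + c 1" for c :: "nat \<Rightarrow> 'a"
    by (simp add: numeral_2_eq_2)
  show "((A \<otimes>\<^sub>K B) *\<^sub>v v) $ i =
      A $$ (0, 0) * (\<Sum>l<n. B $$ (i, l) * v $ l) + A $$ (0, 1) * (\<Sum>l<n. B $$ (i, l) * v $ (n + l))"
    and "((A \<otimes>\<^sub>K B) *\<^sub>v v) $ (n + i) =
      A $$ (1, 0) * (\<Sum>l<n. B $$ (i, l) * v $ l) + A $$ (1, 1) * (\<Sum>l<n. B $$ (i, l) * v $ (n + l))"
    using index_kron_mult_vec[of v A B 0 i] index_kron_mult_vec[of v A B 1 i] assms(3,4)
    unfolding dim sum2 by simp_all
qed

lemma sum_mult_delta:
  fixes f :: "nat \<Rightarrow> 'a::semiring_0"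
  assumes "i < n"
  shows "(\<Sum>l<n. (if i = l then c l else 0) * f l) = c i * f i"
  using assms by (simp add: if_distrib[of "\<lambda>z. z * _"] cong: if_cong)

section \<open>The difference operators\<close>

text \<open>Each row is the mean of a forward and a backward difference, where a difference reaching
  outside the grid is dropped. This one formula covers interior and boundary rows.\<close>

lemma Q_mat_row:
  assumes "N \<ge> 1" "i \<le> N"
  shows "(\<Sum>j<N + 1. Q_mat N $$ (i, j) * r j) =
    ((if i < N then r (i + 1) - r i else 0) + (if 0 < i then r i - r (i - 1) else 0)) / 2"
proof -
  \<comment> \<open>A row is a sum of three deltas. For \<open>i = 0\<close> the truncated index
    \<open>i - 1\<close> is again \<open>0\<close>, so the guard \<open>0 < i\<close> must switch
    off the third delta.\<close>
  have "(\<Sum>j<N + 1. Q_mat N $$ (i, j) * r j) =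
    (\<Sum>j<N + 1. (if j = i then (if i = 0 then - 1/2 else if i = N then 1/2 else 0) * r j else 0)
      + (if j = i + 1 then (if i < N then 1/2 else 0) * r j else 0)
      + (if j = i - 1 then (if 0 < i then - 1/2 else 0) * r j else 0))"
    using assms by (intro sum.cong refl) (auto simp: Q_mat_def)
  then show ?thesis
    unfolding sum.distrib sum.delta[OF finite_lessThan] using assms
    by (cases "i = 0"; cases "i = N") (simp_all add: field_simps)
qed

text \<open>The second difference is the forward difference minus the backward one, with the same
  boundary convention as for \<open>Q_mat\<close>.\<close>

lemma A_mat_row:
  assumes "N \<ge> 1" "i \<le> N"
  shows "(\<Sum>j<N + 1. A_mat N $$ (i, j) * r j) =
    (if i < N then r (i + 1) - r i else 0) - (if 0 < i then r i - r (i - 1) else 0)"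
proof -
  have "(\<Sum>j<N + 1. A_mat N $$ (i, j) * r j) =
    (\<Sum>j<N + 1. (if j = i then (if i = 0 \<or> i = N then - 1 else - 2) * r j else 0)
      + (if j = i + 1 then (if i < N then 1 else 0) * r j else 0)
      + (if j = i - 1 then (if 0 < i then 1 else 0) * r j else 0))"
    using assms by (intro sum.cong refl) (auto simp: A_mat_def)
  then show ?thesis
    unfolding sum.distrib sum.delta[OF finite_lessThan] using assms
    by (cases "i = 0"; cases "i = N") (simp_all add: field_simps)
qed

text \<open>A sum over nodes becomes a sum over the \<open>N\<close> intervals between them, each
  weighted by \<open>f\<close> at its left end. The backward version below takes the right end
  instead, by an index shift.\<close>

lemma sum_forward_difference:
  fixes f r :: "nat \<Rightarrow> real"
  shows "(\<Sum>i<N + 1. f i * (if i < N then r (i + 1) - r i else 0)) = (\<Sum>i<N. f i * (r (i + 1) - r i))"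
  by simp

lemma sum_backward_difference:
  fixes f r :: "nat \<Rightarrow> real"
  shows "(\<Sum>i<N + 1. f i * (if 0 < i then r i - r (i - 1) else 0)) =
    (\<Sum>i<N. f (i + 1) * (r (i + 1) - r i))"
  unfolding Suc_eq_plus1[symmetric] sum.lessThan_Suc_shift by simp

text \<open>A discrete product rule: on each interval, the mean of \<open>f\<close> times the
  increment of \<open>r\<close>, plus the same with \<open>f\<close> and \<open>r\<close> exchanged,
  is the increment of \<open>f * r\<close>. These increments telescope.\<close>

lemma Q_mat_summation_by_parts:
  assumes "N \<ge> 1"
  shows "(\<Sum>i<N + 1. f i * (\<Sum>j<N + 1. Q_mat N $$ (i, j) * r j))
    + (\<Sum>i<N + 1. r i * (\<Sum>j<N + 1. Q_mat N $$ (i, j) * f j)) = f N * r N - f 0 * r 0"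
proof -
  \<comment> \<open>Adding the left-end and right-end weights gives the trapezoidal rule for the
    integral of \<open>f\<close> with respect to \<open>r\<close>.\<close>
  have half: "(\<Sum>i<N + 1. f i * (\<Sum>j<N + 1. Q_mat N $$ (i, j) * r j)) =
    (\<Sum>i<N. (f i + f (i + 1)) * (r (i + 1) - r i) / 2)" for f r
  proof -
    have "(\<Sum>i<N + 1. f i * (\<Sum>j<N + 1. Q_mat N $$ (i, j) * r j)) =
      ((\<Sum>i<N + 1. f i * (if i < N then r (i + 1) - r i else 0))
        + (\<Sum>i<N + 1. f i * (if 0 < i then r i - r (i - 1) else 0))) / 2"
      unfolding sum.distrib[symmetric] sum_divide_distrib
      by (rule sum.cong[OF refl], subst Q_mat_row) (use assms in \<open>auto simp: field_simps\<close>)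
    then show ?thesis
      unfolding sum_forward_difference sum_backward_difference
      by (simp add: sum_divide_distrib add_divide_distrib distrib_right flip: sum.distrib)
  qed
  have "(\<Sum>i<N. (f i + f (i + 1)) * (r (i + 1) - r i) / 2)
      + (\<Sum>i<N. (r i + r (i + 1)) * (f (i + 1) - f i) / 2)
      = (\<Sum>i<N. f (Suc i) * r (Suc i) - f i * r i)"
    unfolding sum.distrib[symmetric] by (intro sum.cong) (auto simp: field_simps)
  also have "\<dots> = f N * r N - f 0 * r 0"
    by (rule sum_lessThan_telescope)
  finally show ?thesis
    unfolding half .
qed

text \<open>The left-end weight minus the right-end weight is the negative increment of
  \<open>f\<close>, so the form is minus the sum of the squared increments.\<close>

lemma A_mat_nonpos:
  assumes "N \<ge> 1"
  shows "(\<Sum>i<N + 1. f i * (\<Sum>j<N + 1. A_mat N $$ (i, j) * f j)) \<le> 0"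
proof -
  have "(\<Sum>i<N + 1. f i * (\<Sum>j<N + 1. A_mat N $$ (i, j) * f j)) =
    (\<Sum>i<N + 1. f i * (if i < N then f (i + 1) - f i else 0))
      - (\<Sum>i<N + 1. f i * (if 0 < i then f i - f (i - 1) else 0))"
    unfolding sum_subtractf[symmetric]
    by (rule sum.cong[OF refl], subst A_mat_row) (use assms in \<open>auto simp: algebra_simps\<close>)
  also have "\<dots> = (\<Sum>i<N. - (f (i + 1) - f i)\<^sup>2)"
    unfolding sum_forward_difference sum_backward_difference sum_subtractf[symmetric]
    by (intro sum.cong) (auto simp: power2_eq_square algebra_simps)
  also have "\<dots> \<le> 0"
    by (intro sum_nonpos) simp
  finally show ?thesis .
qed

section \<open>The spectral decomposition of the boundary form\<close>

text \<open>The symmetric matrix with rows \<open>(a + b + r, 1)\<close> and \<open>(1, r)\<close>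
  has eigenvectors \<open>(a, 1)\<close> and \<open>(b, 1)\<close> with eigenvalues
  \<open>a + r\<close> and \<open>b + r\<close>. The assumption says that they are
  orthogonal.\<close>

lemma spectral_form:
  fixes a b r y z :: real
  assumes "a * b = - 1"
  shows "(a + r) * (a * y + z)\<^sup>2 / (a\<^sup>2 + 1) + (b + r) * (b * y + z)\<^sup>2 / (b\<^sup>2 + 1)
    = (a + b + r) * y\<^sup>2 + 2 * y * z + r * z\<^sup>2"
proof -
  have a: "a \<noteq> 0" using assms by auto
  have b: "b = - 1 / a" using assms a by (simp add: field_simps)
  have pos: "a\<^sup>2 + 1 > 0" by (simp add: add_nonneg_pos)
  \<comment> \<open>Up to scaling, \<open>(b, 1)\<close> is \<open>(-1, a)\<close>, which brings
    both squares over the denominator a^2 + 1.\<close>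
  have "(b * y + z)\<^sup>2 / (b\<^sup>2 + 1) = (a * z - y)\<^sup>2 / (a\<^sup>2 + 1)"
  proof -
    have "(b * y + z)\<^sup>2 = (a * z - y)\<^sup>2 / a\<^sup>2" "b\<^sup>2 + 1 = (a\<^sup>2 + 1) / a\<^sup>2"
      unfolding b using a by (simp_all add: field_simps power2_eq_square)
    then show ?thesis using a by simp
  qed
  then have "(a + r) * (a * y + z)\<^sup>2 / (a\<^sup>2 + 1) + (b + r) * (b * y + z)\<^sup>2 / (b\<^sup>2 + 1)
      = ((a + r) * (a * y + z)\<^sup>2 + (b + r) * (a * z - y)\<^sup>2) / (a\<^sup>2 + 1)"
    by (metis add_divide_distrib times_divide_eq_right)
  also have "(a + r) * (a * y + z)\<^sup>2 + (b + r) * (a * z - y)\<^sup>2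
      = ((a + b + r) * y\<^sup>2 + 2 * y * z + r * z\<^sup>2) * (a\<^sup>2 + 1)"
  proof -
    \<comment> \<open>The two sides differ by a multiple of \<open>a * b + 1\<close>, which is
      zero.\<close>
    have "(a + r) * (a * y + z)\<^sup>2 + (b + r) * (a * z - y)\<^sup>2
      - ((a + b + r) * y\<^sup>2 + 2 * y * z + r * z\<^sup>2) * (a\<^sup>2 + 1)
      = (a * b + 1) * (a * z\<^sup>2 - a * y\<^sup>2 - 2 * y * z)"
      by (simp add: power2_eq_square algebra_simps)
    then show ?thesis using assms by simp
  qed
  finally show ?thesis using pos by simp
qed

text \<open>This is \<open>spectral_form\<close> for \<open>r = U / g\<close>, scaled by
  \<open>g * H\<close>: \<open>a\<close> and \<open>b\<close> are the upper entries of the columns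
  of \<open>S\<close> before normalization, and the right-hand side is the quadratic form of
  \<open>W M\<close>.\<close>

lemma S_mat_diagonalizes:
  assumes "g > 0" "H > 0" "U\<^sup>2 > g * H"
  shows "g * H * (lambda1 g H U * (S_mat g H U $$ (0, 0) * y + S_mat g H U $$ (1, 0) * z)\<^sup>2
      + lambda2 g H U * (S_mat g H U $$ (0, 1) * y + S_mat g H U $$ (1, 1) * z)\<^sup>2)
    = g * U * y\<^sup>2 + 2 * g * H * y * z + H * U * z\<^sup>2"
proof -
  define a where "a = lambda1 g H U - U / g"
  define b where "b = lambda2 g H U - U / g"
  define R where "R = U\<^sup>2 * (g + H)\<^sup>2 + 4 * g * H * (g * H - U\<^sup>2)"
  \<comment> \<open>As a sum of squares the discriminant is nonnegative, so its square root squares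
    back to \<open>R\<close>.\<close>
  have "R = U\<^sup>2 * (g - H)\<^sup>2 + 4 * (g * H)\<^sup>2"
    unfolding R_def by (simp add: power2_eq_square algebra_simps)
  then have sq: "sqrt R * sqrt R = R" by simp
  have l1: "lambda1 g H U = (U * (g + H) + sqrt R) / (2 * g * H)"
    and l2: "lambda2 g H U = (U * (g + H) - sqrt R) / (2 * g * H)"
    by (simp_all add: lambda1_def lambda2_def R_def)
  have ga: "2 * g * H * a = U * (g - H) + sqrt R" and gb: "2 * g * H * b = U * (g - H) - sqrt R"
    unfolding a_def b_def l1 l2 using assms by (simp_all add: field_simps)
  \<comment> \<open>Orthogonality of the columns: the product of the conjugate expressions is
    \<open>(U * (g - H))^2 - R\<close>, which is \<open>- (2 * g * H)^2\<close>.\<close>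
  have "(2 * g * H * a) * (2 * g * H * b) = (2 * g * H)\<^sup>2 * (- 1)"
  proof -
    have "(U * (g - H) + sqrt R) * (U * (g - H) - sqrt R) = (U * (g - H))\<^sup>2 - R"
      using sq by (simp add: power2_eq_square algebra_simps)
    then show ?thesis
      unfolding ga gb R_def by (simp add: power2_eq_square algebra_simps)
  qed
  then have "(2 * g * H)\<^sup>2 * (a * b) = (2 * g * H)\<^sup>2 * (- 1)"
    by (simp add: power2_eq_square ac_simps)
  then have ab: "a * b = - 1" using assms by (subst (asm) mult_cancel_left) simp
  have "g * H * (a + b) = U * (g - H)" using ga gb by (simp add: algebra_simps)
  then have s: "g * H * (a + b + U / g) = g * U" using assms by (simp add: algebra_simps)
  have norm: "(1 / sqrt (k\<^sup>2 + 1) * k * y + 1 / sqrt (k\<^sup>2 + 1) * z)\<^sup>2 = (k * y + z)\<^sup>2 / (k\<^sup>2 + 1)" for k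
  proof -
    have "1 / sqrt (k\<^sup>2 + 1) * k * y + 1 / sqrt (k\<^sup>2 + 1) * z = (k * y + z) / sqrt (k\<^sup>2 + 1)"
      by (simp add: add_divide_distrib)
    then show ?thesis by (simp add: power_divide)
  qed
  have S: "S_mat g H U = mat_of_rows_list 2
     [[1 / sqrt (a\<^sup>2 + 1) * a, 1 / sqrt (b\<^sup>2 + 1) * b], [1 / sqrt (a\<^sup>2 + 1), 1 / sqrt (b\<^sup>2 + 1)]]"
    by (simp add: S_mat_def Let_def a_def b_def)
  have w1: "(S_mat g H U $$ (0, 0) * y + S_mat g H U $$ (1, 0) * z)\<^sup>2 = (a * y + z)\<^sup>2 / (a\<^sup>2 + 1)"
    and w2: "(S_mat g H U $$ (0, 1) * y + S_mat g H U $$ (1, 1) * z)\<^sup>2 = (b * y + z)\<^sup>2 / (b\<^sup>2 + 1)"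
    unfolding norm[symmetric] by (simp_all add: S mat_of_rows_list_def)
  have l: "lambda1 g H U = a + U / g" "lambda2 g H U = b + U / g"
    by (simp_all add: a_def b_def)
  have "g * H * ((a + U / g) * ((a * y + z)\<^sup>2 / (a\<^sup>2 + 1)) + (b + U / g) * ((b * y + z)\<^sup>2 / (b\<^sup>2 + 1)))
      = g * H * ((a + b + U / g) * y\<^sup>2 + 2 * y * z + U / g * z\<^sup>2)"
    using spectral_form[OF ab, of "U / g" y z] by simp
  also have "\<dots> = (g * H * (a + b + U / g)) * y\<^sup>2 + 2 * g * H * y * z + H * U * z\<^sup>2"
    using assms by (simp add: algebra_simps)
  finally show ?thesis unfolding w1 w2 l s .
qed

text \<open>Completing the square after multiplication by \<open>g\<close> leaves the coefficient g
  H (U^2 - g H), nonnegative for super-critical flow. The factor \<open>U\<close> treats both flow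
  directions at once.\<close>

lemma supercritical_definite:
  fixes g H U y z :: real
  assumes "g > 0" "H > 0" "U\<^sup>2 > g * H"
  shows "0 \<le> U * (g * U * y\<^sup>2 + 2 * g * H * y * z + H * U * z\<^sup>2)"
proof -
  have "g * (U * (g * U * y\<^sup>2 + 2 * g * H * y * z + H * U * z\<^sup>2))
      = (g * U * y + g * H * z)\<^sup>2 + g * H * (U\<^sup>2 - g * H) * z\<^sup>2"
    by (simp add: power2_eq_square algebra_simps)
  also have "\<dots> \<ge> 0"
    using assms by (intro add_nonneg_nonneg mult_nonneg_nonneg) auto
  finally show ?thesis
    using assms by (simp add: zero_le_mult_iff)
qed

section \<open>The penalty term and the discrete norm\<close>

lemma small_mat_carriers:
  "M_mat g H U \<in> carrier_mat 2 2" "W_mat g H \<in> carrier_mat 2 2" "S_mat g H U \<in> carrier_mat 2 2"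
  by (auto simp only: M_mat_def W_mat_def S_mat_def mat_of_rows_list_def Let_def list.size carrier_mat_def
    dim_row_mat dim_col_mat)

lemma W_mat_index:
  "W_mat g H $$ (0, 0) = g" "W_mat g H $$ (0, 1) = 0"
  "W_mat g H $$ (1, 0) = 0" "W_mat g H $$ (1, 1) = H"
  by (simp_all add: W_mat_def mat_of_rows_list_def)

lemma M_mat_index:
  "M_mat g H U $$ (0, 0) = U" "M_mat g H U $$ (0, 1) = H"
  "M_mat g H U $$ (1, 0) = g" "M_mat g H U $$ (1, 1) = U"
  by (simp_all add: M_mat_def mat_of_rows_list_def)

lemma index_mult_mat2:
  fixes A B :: "'a::comm_semiring_0 mat"
  assumes "A \<in> carrier_mat 2 2" "B \<in> carrier_mat 2 2" "i < 2" "j < 2"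
  shows "(A * B) $$ (i, j) = A $$ (i, 0) * B $$ (0, j) + A $$ (i, 1) * B $$ (1, j)"
  using assms by (simp add: scalar_prod_def numeral_2_eq_2)

text \<open>These are the entries of \<open>W K = S W\<close>: the energy weight \<open>W\<close>
  cancels the inverse in the penalty, whose entries never have to be computed.\<close>

lemma W_mat_mult_penalty_mat:
  fixes g H U :: real
  assumes "g > 0" "H > 0"
  defines "K \<equiv> W_inv g H * S_mat g H U * W_mat g H"
  shows "K \<in> carrier_mat 2 2"
    and "g * K $$ (0, 0) = S_mat g H U $$ (0, 0) * g" "g * K $$ (0, 1) = S_mat g H U $$ (0, 1) * H"
    and "H * K $$ (1, 0) = S_mat g H U $$ (1, 0) * g" "H * K $$ (1, 1) = S_mat g H U $$ (1, 1) * H"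
proof -
  note W = W_inv_inverse[OF assms(1,2)] and c = small_mat_carriers
  have SW: "S_mat g H U * W_mat g H \<in> carrier_mat 2 2"
    by (intro mult_carrier_mat[of _ 2 2] c)
  show K: "K \<in> carrier_mat 2 2"
    unfolding K_def by (intro mult_carrier_mat[of _ 2 2] W(3) c)
  have "W_mat g H * K = (W_mat g H * W_inv g H) * (S_mat g H U * W_mat g H)"
    unfolding K_def
    by (simp only: assoc_mult_mat[OF W(3) c(3) c(2)] assoc_mult_mat[OF c(2) W(3) SW])
  also have "\<dots> = S_mat g H U * W_mat g H"
    unfolding W(1) by (rule left_mult_one_mat[OF SW])
  finally have eq: "W_mat g H * K = S_mat g H U * W_mat g H" .
  have "(W_mat g H * K) $$ (i, j) = (S_mat g H U * W_mat g H) $$ (i, j)" for i j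
    unfolding eq ..
  then have ij: "W_mat g H $$ (i, 0) * K $$ (0, j) + W_mat g H $$ (i, 1) * K $$ (1, j) =
      S_mat g H U $$ (i, 0) * W_mat g H $$ (0, j) + S_mat g H U $$ (i, 1) * W_mat g H $$ (1, j)"
    if "i < 2" "j < 2" for i j
    using index_mult_mat2[OF c(2) K that] index_mult_mat2[OF c(3) c(2) that] by metis
  show "g * K $$ (0, 0) = S_mat g H U $$ (0, 0) * g" "g * K $$ (0, 1) = S_mat g H U $$ (0, 1) * H"
    and "H * K $$ (1, 0) = S_mat g H U $$ (1, 0) * g" "H * K $$ (1, 1) = S_mat g H U $$ (1, 1) * H"
    using ij[of 0 0] ij[of 0 1] ij[of 1 0] ij[of 1 1] W_mat_index[of g H] by simp_all
qed

lemma char_vars_index: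
  "char_vars g H U N q i $ 0 = S_mat g H U $$ (0, 0) * q $ i + S_mat g H U $$ (1, 0) * q $ (N + 1 + i)"
  "char_vars g H U N q i $ 1 = S_mat g H U $$ (0, 1) * q $ i + S_mat g H U $$ (1, 1) * q $ (N + 1 + i)"
  using small_mat_carriers(3)[of g H U]
  by (simp_all add: char_vars_def node_state_def scalar_prod_def numeral_2_eq_2)

text \<open>After \<open>W K = S W\<close>, the factors \<open>g\<close>, \<open>H\<close> of
  \<open>W\<close> complete the factors \<open>H\<close>, \<open>g\<close> of the penalty data to
  \<open>g * H\<close>. Pairing the columns of \<open>S\<close> with the state at \<open>b\<close>
  yields the characteristic variables a second time, hence squares.\<close>

lemma penalty_work:
  assumes "g > 0" "H > 0" "b \<le> N"
  shows "(\<Sum>i<N + 1. g * q $ i * penalty g H U N \<tau>1 \<tau>2 b q $ i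
      + H * q $ (N + 1 + i) * penalty g H U N \<tau>1 \<tau>2 b q $ (N + 1 + i))
    = - (1 / 2) * (g * H * (\<tau>1 * (char_vars g H U N q b $ 0)\<^sup>2 + \<tau>2 * (char_vars g H U N q b $ 1)\<^sup>2))"
proof -
  define K where "K = W_inv g H * S_mat g H U * W_mat g H"
  define w1 where "w1 = char_vars g H U N q b $ 0"
  define w2 where "w2 = char_vars g H U N q b $ 1"
  define z where "z = ((\<tau>1 * H * w1) \<cdot>\<^sub>v unit_vec (N + 1) b) @\<^sub>v ((\<tau>2 * g * w2) \<cdot>\<^sub>v unit_vec (N + 1) b)"
  note K = W_mat_mult_penalty_mat[OF assms(1,2), of U, folded K_def]
  have pen: "penalty g H U N \<tau>1 \<tau>2 b q = (- (1 / 2)) \<cdot>\<^sub>v ((K \<otimes>\<^sub>K 1\<^sub>m (N + 1)) *\<^sub>v z)"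
    by (simp add: penalty_def K_def z_def w1_def w2_def)
  have z: "dim_vec z = 2 * (N + 1)" "\<And>l. l < N + 1 \<Longrightarrow> z $ l = (if l = b then \<tau>1 * H * w1 else 0)"
    "\<And>l. l < N + 1 \<Longrightarrow> z $ (N + 1 + l) = (if l = b then \<tau>2 * g * w2 else 0)"
    by (auto simp: z_def unit_vec_def)
  have one: "(\<Sum>l<N + 1. 1\<^sub>m (N + 1) $$ (i, l) * f l) = f i" if "i < N + 1" for i and f :: "nat \<Rightarrow> real"
  proof -
    have "(\<Sum>l<N + 1. 1\<^sub>m (N + 1) $$ (i, l) * f l) = (\<Sum>l<N + 1. (if i = l then 1 else 0) * f l)"
      using that by (intro sum.cong) auto
    then show ?thesis using sum_mult_delta[OF that, of "\<lambda>_. 1" f] by simp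
  qed
  have dim: "dim_vec ((K \<otimes>\<^sub>K 1\<^sub>m (N + 1)) *\<^sub>v z) = 2 * (N + 1)"
    using K(1) by simp
  have p: "penalty g H U N \<tau>1 \<tau>2 b q $ i = - (1 / 2) * (K $$ (0, 0) * z $ i + K $$ (0, 1) * z $ (N + 1 + i))"
    "penalty g H U N \<tau>1 \<tau>2 b q $ (N + 1 + i) = - (1 / 2) * (K $$ (1, 0) * z $ i + K $$ (1, 1) * z $ (N + 1 + i))"
    if "i < N + 1" for i
    using index_kron2_mult_vec[OF K(1) one_carrier_mat z(1) that] that
      index_smult_vec(1)[of i "(K \<otimes>\<^sub>K 1\<^sub>m (N + 1)) *\<^sub>v z" "- (1 / 2)"]
      index_smult_vec(1)[of "N + 1 + i" "(K \<otimes>\<^sub>K 1\<^sub>m (N + 1)) *\<^sub>v z" "- (1 / 2)"]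
    unfolding pen one[OF that] dim by simp_all
  \<comment> \<open>Only node \<open>b\<close> contributes. The products of \<open>g\<close> and
    \<open>H\<close> with entries of \<open>K\<close> are kept as factors so that
    \<open>W K = S W\<close> applies.\<close>
  have "g * q $ i * penalty g H U N \<tau>1 \<tau>2 b q $ i
      + H * q $ (N + 1 + i) * penalty g H U N \<tau>1 \<tau>2 b q $ (N + 1 + i)
    = (if i = b then - (1 / 2) * (q $ b * ((g * K $$ (0, 0)) * (\<tau>1 * H * w1) + (g * K $$ (0, 1)) * (\<tau>2 * g * w2))
        + q $ (N + 1 + b) * ((H * K $$ (1, 0)) * (\<tau>1 * H * w1) + (H * K $$ (1, 1)) * (\<tau>2 * g * w2))) else 0)"
    if "i < N + 1" for i
    unfolding p[OF that] z(2,3)[OF that] by (simp add: algebra_simps)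
  moreover have "b < N + 1"
    using assms(3) by simp
  ultimately have "(\<Sum>i<N + 1. g * q $ i * penalty g H U N \<tau>1 \<tau>2 b q $ i
      + H * q $ (N + 1 + i) * penalty g H U N \<tau>1 \<tau>2 b q $ (N + 1 + i))
    = - (1 / 2) * (q $ b * ((g * K $$ (0, 0)) * (\<tau>1 * H * w1) + (g * K $$ (0, 1)) * (\<tau>2 * g * w2))
        + q $ (N + 1 + b) * ((H * K $$ (1, 0)) * (\<tau>1 * H * w1) + (H * K $$ (1, 1)) * (\<tau>2 * g * w2)))"
    by simp
  also have "\<dots> = - (1 / 2) * (g * H * (\<tau>1 * w1 * (S_mat g H U $$ (0, 0) * q $ b + S_mat g H U $$ (1, 0) * q $ (N + 1 + b))
      + \<tau>2 * w2 * (S_mat g H U $$ (0, 1) * q $ b + S_mat g H U $$ (1, 1) * q $ (N + 1 + b))))"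
    unfolding K by (simp add: algebra_simps)
  also have "\<dots> = - (1 / 2) * (g * H * (\<tau>1 * w1\<^sup>2 + \<tau>2 * w2\<^sup>2))"
    unfolding char_vars_index[symmetric] w1_def w2_def by (simp add: power2_eq_square)
  finally show ?thesis
    unfolding w1_def w2_def .
qed

lemma P_mat_row:
  assumes "i < N + 1"
  shows "(\<Sum>l<N + 1. P_mat N x $$ (i, l) * f l) = cell_length N x i * f i"
proof -
  have "(\<Sum>l<N + 1. P_mat N x $$ (i, l) * f l)
      = (\<Sum>l<N + 1. (if i = l then cell_length N x l else 0) * f l)"
    using assms by (intro sum.cong) (auto simp: P_mat_def mat_diag_def)
  then show ?thesis
    unfolding sum_mult_delta[OF assms] .
qed

lemma mat_carriers:
  "P_mat N x \<in> carrier_mat (N + 1) (N + 1)" "Q_mat N \<in> carrier_mat (N + 1) (N + 1)"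
  "A_mat N \<in> carrier_mat (N + 1) (N + 1)"
  by (simp_all add: P_mat_def Q_mat_def A_mat_def)

lemma WP_norm_sq_eq_sum:
  assumes "dim_vec q = 2 * (N + 1)"
  shows "WP_norm_sq g H N x q =
    (\<Sum>i<N + 1. cell_length N x i * (g * (q $ i)\<^sup>2 + H * (q $ (N + 1 + i))\<^sup>2))"
proof -
  let ?y = "(W_mat g H \<otimes>\<^sub>K P_mat N x) *\<^sub>v q"
  have y: "?y $ i = g * (cell_length N x i * q $ i)"
    "?y $ (N + 1 + i) = H * (cell_length N x i * q $ (N + 1 + i))" if "i < N + 1" for i
    unfolding index_kron2_mult_vec[OF small_mat_carriers(2) mat_carriers(1) assms that]
      P_mat_row[OF that] W_mat_index by simp_all
  have "dim_vec ?y = 2 * (N + 1)"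
    using small_mat_carriers(2)[of g H] mat_carriers(1)[of N x] by simp
  then have "WP_norm_sq g H N x q = (\<Sum>i<2 * (N + 1). q $ i * ?y $ i)"
    unfolding WP_norm_sq_def scalar_prod_def atLeast0LessThan by simp
  also have "\<dots> = (\<Sum>i<N + 1. q $ i * ?y $ i + q $ (N + 1 + i) * ?y $ (N + 1 + i))"
    unfolding sum_lessThan_double sum.distrib ..
  also have "\<dots> = (\<Sum>i<N + 1. cell_length N x i * (g * (q $ i)\<^sup>2 + H * (q $ (N + 1 + i))\<^sup>2))"
    by (intro sum.cong refl) (simp only: lessThan_iff y, simp add: power2_eq_square algebra_simps)
  finally show ?thesis .
qed

text \<open>The factor \<open>cell_length N x i * v $ i\<close> is kept together because it is an
  entry of the term with \<open>P\<close>, for which the scheme is solved later.\<close>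

lemma WP_norm_sq_has_derivative:
  assumes "has_vec_deriv q v t T" "dim_vec v = 2 * (N + 1)" "t \<in> T"
  shows "((\<lambda>s. WP_norm_sq g H N x (q s)) has_real_derivative
    2 * (\<Sum>i<N + 1. g * q t $ i * (cell_length N x i * v $ i)
      + H * q t $ (N + 1 + i) * (cell_length N x i * v $ (N + 1 + i)))) (at t within T)"
proof -
  have dim: "dim_vec (q s) = 2 * (N + 1)" if "s \<in> T" for s
    using assms that by (simp add: has_vec_deriv_def)
  have d: "((\<lambda>s. q s $ i) has_real_derivative v $ i) (at t within T)" if "i < 2 * (N + 1)" for i
    using assms that by (simp add: has_vec_deriv_def)
  have deriv: "((\<lambda>s. \<Sum>i<N + 1. cell_length N x i * (g * (q s $ i)\<^sup>2 + H * (q s $ (N + 1 + i))\<^sup>2)) has_real_derivative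
    (\<Sum>i<N + 1. cell_length N x i * (g * (2 * q t $ i * v $ i) + H * (2 * q t $ (N + 1 + i) * v $ (N + 1 + i)))))
      (at t within T)"
    by (rule DERIV_sum) (auto intro!: derivative_eq_intros d)
  have eq: "(\<Sum>i<N + 1. cell_length N x i * (g * (2 * q t $ i * v $ i) + H * (2 * q t $ (N + 1 + i) * v $ (N + 1 + i))))
    = 2 * (\<Sum>i<N + 1. g * q t $ i * (cell_length N x i * v $ i)
      + H * q t $ (N + 1 + i) * (cell_length N x i * v $ (N + 1 + i)))"
    unfolding sum_distrib_left by (intro sum.cong refl) (simp add: algebra_simps)
  \<comment> \<open>The sum formula for the norm needs the dimension of \<open>q s\<close>, known
    only for \<open>s\<close> in \<open>T\<close>, so the derivative is transferred within
    \<open>T\<close>. Any positive radius \<open>d\<close> would do.\<close>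
  show ?thesis
    by (rule has_field_derivative_transform_within[OF deriv[unfolded eq], where d = 1])
      (simp_all only: zero_less_one assms(3) WP_norm_sq_eq_sum[OF dim])
qed

section \<open>The energy estimate\<close>

text \<open>The node \<open>b\<close> carrying the penalty is left open, so one estimate serves both
  flow directions. Transport leaves the boundary values of \<open>E\<close>, the quadratic form of
  \<open>W M\<close>, and the dissipation only lowers the rate.\<close>

lemma energy_rate:
  assumes "g > 0" "H > 0" "\<alpha> \<ge> 0" "N \<ge> 1" "b \<le> N"
    and q: "dim_vec q = 2 * (N + 1)" and v: "dim_vec v = 2 * (N + 1)"
    and scheme: "(1\<^sub>m 2 \<otimes>\<^sub>K P_mat N x) *\<^sub>v v + (M_mat g H U \<otimes>\<^sub>K Q_mat N) *\<^sub>v q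
         - (\<alpha> / 2) \<cdot>\<^sub>v ((1\<^sub>m 2 \<otimes>\<^sub>K A_mat N) *\<^sub>v q) = penalty g H U N \<tau>1 \<tau>2 b q"
  defines "E \<equiv> \<lambda>i. g * U * (q $ i)\<^sup>2 + 2 * g * H * q $ i * q $ (N + 1 + i) + H * U * (q $ (N + 1 + i))\<^sup>2"
  shows "2 * (\<Sum>i<N + 1. g * q $ i * (cell_length N x i * v $ i)
      + H * q $ (N + 1 + i) * (cell_length N x i * v $ (N + 1 + i)))
    \<le> E 0 - E N - g * H * (\<tau>1 * (char_vars g H U N q b $ 0)\<^sup>2 + \<tau>2 * (char_vars g H U N q b $ 1)\<^sup>2)"
proof -
  define h where "h = (\<lambda>i. q $ i)"
  define u where "u = (\<lambda>i. q $ (N + 1 + i))"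
  define Q where "Q = (\<lambda>(r::nat \<Rightarrow> real) i. \<Sum>j<N + 1. Q_mat N $$ (i, j) * r j)"
  define A where "A = (\<lambda>(r::nat \<Rightarrow> real) i. \<Sum>j<N + 1. A_mat N $$ (i, j) * r j)"
  define p where "p = penalty g H U N \<tau>1 \<tau>2 b q"
  note c = mat_carriers small_mat_carriers one_carrier_mat[of 2]
  have one: "1\<^sub>m 2 $$ (0, 0) = (1::real)" "1\<^sub>m 2 $$ (0, 1) = (0::real)"
    "1\<^sub>m 2 $$ (1, 0) = (0::real)" "1\<^sub>m 2 $$ (1, 1) = (1::real)"
    by simp_all
  have dims: "dim_vec ((1\<^sub>m 2 \<otimes>\<^sub>K P_mat N x) *\<^sub>v v) = 2 * (N + 1)"
    "dim_vec ((M_mat g H U \<otimes>\<^sub>K Q_mat N) *\<^sub>v q) = 2 * (N + 1)"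
    "dim_vec ((1\<^sub>m 2 \<otimes>\<^sub>K A_mat N) *\<^sub>v q) = 2 * (N + 1)"
    using mat_carriers(1)[of N x, THEN carrier_matD(1)] mat_carriers(2,3)[of N, THEN carrier_matD(1)]
      small_mat_carriers(1)[of g H U, THEN carrier_matD(1)] by simp_all
  have at: "p $ k = ((1\<^sub>m 2 \<otimes>\<^sub>K P_mat N x) *\<^sub>v v) $ k + ((M_mat g H U \<otimes>\<^sub>K Q_mat N) *\<^sub>v q) $ k
         - (\<alpha> / 2) * ((1\<^sub>m 2 \<otimes>\<^sub>K A_mat N) *\<^sub>v q) $ k" if "k < 2 * (N + 1)" for k
    unfolding p_def scheme[symmetric] using that dims
    by (simp del: index_mult_mat_vec)
  have eqs: "cell_length N x i * v $ i = p $ i - (U * Q h i + H * Q u i) + \<alpha> / 2 * A h i"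
    "cell_length N x i * v $ (N + 1 + i) = p $ (N + 1 + i) - (g * Q h i + U * Q u i) + \<alpha> / 2 * A u i"
    if i: "i < N + 1" for i
  proof -
    have k: "i < 2 * (N + 1)" "N + 1 + i < 2 * (N + 1)" using i by auto
    show "cell_length N x i * v $ i = p $ i - (U * Q h i + H * Q u i) + \<alpha> / 2 * A h i"
      unfolding at[OF k(1)] index_kron2_mult_vec(1)[OF c(7) c(1) v i]
        index_kron2_mult_vec(1)[OF c(4) c(2) q i] index_kron2_mult_vec(1)[OF c(7) c(3) q i]
        P_mat_row[OF i] M_mat_index one Q_def A_def h_def u_def by simp
    show "cell_length N x i * v $ (N + 1 + i) = p $ (N + 1 + i) - (g * Q h i + U * Q u i) + \<alpha> / 2 * A u i"
      unfolding at[OF k(2)] index_kron2_mult_vec(2)[OF c(7) c(1) v i]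
        index_kron2_mult_vec(2)[OF c(4) c(2) q i] index_kron2_mult_vec(2)[OF c(7) c(3) q i]
        P_mat_row[OF i] M_mat_index one Q_def A_def h_def u_def by simp
  qed
  have sbp: "(\<Sum>i<N + 1. f i * Q r i) + (\<Sum>i<N + 1. r i * Q f i) = f N * r N - f 0 * r 0" for f r
    unfolding Q_def by (rule Q_mat_summation_by_parts[OF assms(4)])
  have "(\<Sum>i<N + 1. g * q $ i * (cell_length N x i * v $ i)
      + H * q $ (N + 1 + i) * (cell_length N x i * v $ (N + 1 + i)))
    = (\<Sum>i<N + 1. (g * h i * p $ i + H * u i * p $ (N + 1 + i))
        - g * U * (h i * Q h i) - g * H * (h i * Q u i) - g * H * (u i * Q h i) - H * U * (u i * Q u i)
        + \<alpha> / 2 * (g * (h i * A h i)) + \<alpha> / 2 * (H * (u i * A u i)))"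
    by (intro sum.cong refl) (simp only: lessThan_iff eqs, simp add: h_def u_def algebra_simps)
  also have "\<dots> = (\<Sum>i<N + 1. g * h i * p $ i + H * u i * p $ (N + 1 + i))
      - g * U * (\<Sum>i<N + 1. h i * Q h i) - g * H * (\<Sum>i<N + 1. h i * Q u i)
      - g * H * (\<Sum>i<N + 1. u i * Q h i) - H * U * (\<Sum>i<N + 1. u i * Q u i)
      + \<alpha> / 2 * (g * (\<Sum>i<N + 1. h i * A h i)) + \<alpha> / 2 * (H * (\<Sum>i<N + 1. u i * A u i))"
    by (simp only: sum.distrib sum_subtractf sum_distrib_left)
  \<comment> \<open>Since \<open>W M\<close> is symmetric, the two mixed sums share the weight
    \<open>g * H\<close> and pair up for summation by parts. The factor 2 supplies the second copy
    of each unmixed sum.\<close>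
  finally have rate: "2 * (\<Sum>i<N + 1. g * q $ i * (cell_length N x i * v $ i)
      + H * q $ (N + 1 + i) * (cell_length N x i * v $ (N + 1 + i)))
    = 2 * (\<Sum>i<N + 1. g * h i * p $ i + H * u i * p $ (N + 1 + i))
      - g * U * (2 * (\<Sum>i<N + 1. h i * Q h i))
      - 2 * g * H * ((\<Sum>i<N + 1. h i * Q u i) + (\<Sum>i<N + 1. u i * Q h i))
      - H * U * (2 * (\<Sum>i<N + 1. u i * Q u i))
      + \<alpha> * (g * (\<Sum>i<N + 1. h i * A h i)) + \<alpha> * (H * (\<Sum>i<N + 1. u i * A u i))"
    by (simp only:) (simp only: algebra_simps, simp)
  have diss: "\<alpha> * (k * (\<Sum>i<N + 1. f i * A f i)) \<le> 0" if "k > 0" for k f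
    unfolding A_def using A_mat_nonpos[OF assms(4), of f] that assms(3)
    by (intro mult_nonneg_nonpos) (auto intro: mult_nonneg_nonpos)
  have work: "2 * (\<Sum>i<N + 1. g * h i * p $ i + H * u i * p $ (N + 1 + i))
    = - (g * H * (\<tau>1 * (char_vars g H U N q b $ 0)\<^sup>2 + \<tau>2 * (char_vars g H U N q b $ 1)\<^sup>2))"
    unfolding h_def u_def p_def penalty_work[OF assms(1,2,5)] by simp
  have hh: "2 * (\<Sum>i<N + 1. f i * Q f i) = f N * f N - f 0 * f 0" for f
    using sbp[of f f] by simp
  show ?thesis
    unfolding rate work hh sbp E_def
    using diss[OF assms(1), of h] diss[OF assms(2), of u]
    by (simp add: h_def u_def power2_eq_square algebra_simps)
qed

theorem theorem10:
  fixes g H U \<alpha> \<tau>01 \<tau>02 \<tau>N1 \<tau>N2 :: real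
    and N :: nat
    and x :: "nat \<Rightarrow> real"
    and q :: "real \<Rightarrow> real vec"
  assumes "g > 0" and "H > 0" and "U\<^sup>2 > g * H" and "\<alpha> \<ge> 0"
    and "N \<ge> 1" and "is_grid N x"
    and "U > 0 \<Longrightarrow> \<tau>01 \<ge> lambda1 g H U \<and> \<tau>02 \<ge> lambda2 g H U"
    and "U < 0 \<Longrightarrow> \<tau>N1 \<ge> - lambda1 g H U \<and> \<tau>N2 \<ge> - lambda2 g H U"
    and "is_solution g H U \<alpha> N x \<tau>01 \<tau>02 \<tau>N1 \<tau>N2 q"
  shows "\<forall>t\<ge>0. \<exists>D. ((\<lambda>s. WP_norm_sq g H N x (q s)) has_real_derivative D) (at t within {0..})
                 \<and> 1 / 2 * D \<le> 0"
proof (intro allI impI)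
  fix t :: real
  assume t: "t \<ge> 0"
  \<comment> \<open>The inflow node and its parameters are selected here, turning \<open>SAT\<close>
    into a single \<open>penalty\<close> term.\<close>
  define b where "b = (if U > 0 then 0 else N)"
  define \<tau>1 where "\<tau>1 = (if U > 0 then \<tau>01 else \<tau>N1)"
  define \<tau>2 where "\<tau>2 = (if U > 0 then \<tau>02 else \<tau>N2)"
  obtain v where v: "dim_vec v = 2 * (N + 1)" "has_vec_deriv q v t {0..}"
    "(1\<^sub>m 2 \<otimes>\<^sub>K P_mat N x) *\<^sub>v v + (M_mat g H U \<otimes>\<^sub>K Q_mat N) *\<^sub>v q t
         - (\<alpha> / 2) \<cdot>\<^sub>v ((1\<^sub>m 2 \<otimes>\<^sub>K A_mat N) *\<^sub>v q t) = penalty g H U N \<tau>1 \<tau>2 b (q t)"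
    using assms(9) t unfolding is_solution_def SAT_def b_def \<tau>1_def \<tau>2_def carrier_vec_def
    by (cases "U > 0") auto
  define D where "D = 2 * (\<Sum>i<N + 1. g * q t $ i * (cell_length N x i * v $ i)
      + H * q t $ (N + 1 + i) * (cell_length N x i * v $ (N + 1 + i)))"
  define E where "E = (\<lambda>i. g * U * (q t $ i)\<^sup>2 + 2 * g * H * q t $ i * q t $ (N + 1 + i)
      + H * U * (q t $ (N + 1 + i))\<^sup>2)"
  define w1 where "w1 = (\<lambda>i. char_vars g H U N (q t) i $ 0)"
  define w2 where "w2 = (\<lambda>i. char_vars g H U N (q t) i $ 1)"
  have deriv: "((\<lambda>s. WP_norm_sq g H N x (q s)) has_real_derivative D) (at t within {0..})"
    unfolding D_def using WP_norm_sq_has_derivative[OF v(2,1)] t by simp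
  have "dim_vec (q t) = 2 * (N + 1)"
    using v(1,2) t by (simp add: has_vec_deriv_def)
  moreover have "b \<le> N"
    by (simp add: b_def)
  ultimately have D: "D \<le> E 0 - E N - g * H * (\<tau>1 * (w1 b)\<^sup>2 + \<tau>2 * (w2 b)\<^sup>2)"
    unfolding D_def E_def w1_def w2_def using energy_rate[OF assms(1,2,4,5) _ _ v(1,3)] by simp
  \<comment> \<open>In characteristic variables the boundary form is diagonal and can be compared
    termwise with the penalty.\<close>
  have E: "E i = g * H * (lambda1 g H U * (w1 i)\<^sup>2 + lambda2 g H U * (w2 i)\<^sup>2)" for i
    unfolding E_def w1_def w2_def char_vars_index S_mat_diagonalizes[OF assms(1-3)] ..
  have sign: "0 \<le> U * E i" for i
    unfolding E_def by (rule supercritical_definite[OF assms(1-3)])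
  have mono: "g * H * (k1 * (w1 b)\<^sup>2 + k2 * (w2 b)\<^sup>2) \<le> g * H * (l1 * (w1 b)\<^sup>2 + l2 * (w2 b)\<^sup>2)"
    if "k1 \<le> l1" "k2 \<le> l2" for k1 k2 l1 l2
    using that assms(1,2) by (intro mult_left_mono add_mono mult_right_mono) auto
  have "U \<noteq> 0"
    using assms(3) mult_pos_pos[OF assms(1,2)] by auto
  then consider "U > 0" | "U < 0" by linarith
  then have "D \<le> 0"
  proof cases
    case 1
    \<comment> \<open>Node \<open>N\<close> is the outflow boundary, where the sign suffices; the
      penalty at node \<open>0\<close> absorbs \<open>E 0\<close>.\<close>
    have "0 \<le> E N" using sign[of N] 1 by (simp add: zero_le_mult_iff)
    moreover have "E 0 \<le> g * H * (\<tau>1 * (w1 b)\<^sup>2 + \<tau>2 * (w2 b)\<^sup>2)"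
      using mono[of "lambda1 g H U" \<tau>1 "lambda2 g H U" \<tau>2] assms(7) 1
      by (simp add: E b_def \<tau>1_def \<tau>2_def)
    ultimately show ?thesis using D by linarith
  next
    case 2
    \<comment> \<open>The boundaries exchange roles. Inflow now enters as \<open>- E N\<close>,
      which explains the negated eigenvalues in the bounds on the parameters.\<close>
    have "E 0 \<le> 0" using sign[of 0] 2 by (simp add: zero_le_mult_iff)
    moreover have "- E N \<le> g * H * (\<tau>1 * (w1 b)\<^sup>2 + \<tau>2 * (w2 b)\<^sup>2)"
      using mono[of "- lambda1 g H U" \<tau>1 "- lambda2 g H U" \<tau>2] assms(8) 2
      by (simp add: E b_def \<tau>1_def \<tau>2_def algebra_simps)
    ultimately show ?thesis using D by linarith
  qed
  with deriv show "\<exists>D. ((\<lambda>s. WP_norm_sq g H N x (q s)) has_real_derivative D) (at t within {0..})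
                 \<and> 1 / 2 * D \<le> 0"
    by (intro exI[of _ D]) simp
qed

end
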